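(* Let $M_1,\dots,M_d\in\mathbb{R}^{m\times n}$ be linearly independent, let $\mathcal{M}=\operatorname{span}(M_1,\dots,M_d)$ be the $d$-dimensional matrix space they span, and let $\mathcal{T}\in\mathbb{R}^{m\times n\times d}$ be the tensor whose $3$-slices are $M_1,\dots,M_d$. Then $\mathcal{M}$ possesses a basis consisting of rank-one matrices if and only if $\mathcal{T}$ has (canonical) rank $d$. Any CP decomposition $$\mathcal{T}=\sum_{\ell=1}^d\mathbf{a}_\ell\circ\mathbf{b}_\ell\circ\mathbf{c}_\ell,\qquad \mathbf{a}_\ell\in\mathbb{R}^m,\ \mathbf{b}_\ell\in\mathbb{R}^n,\ \mathbf{c}_\ell\in\mathbb{R}^d,$$ of $\mathcal{T}$ provides a rank-one basis $\mathbf{a}_1\mathbf{b}_1^T,\dots,\mathbf{a}_d\mathbf{b}_d^T$ of $\mathcal{M}$.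
   Context: The $3$-slices of $\mathcal{T}$ are the matrices $(\mathcal{T}_{ijk})_{i,j}$, so $\mathcal{T}_{ijk}=(M_k)_{ij}$. The outer product is $(\mathbf{a}\circ\mathbf{b}\circ\mathbf{c})_{ijk}=a_ib_jc_k$. The canonical rank of a third-order tensor is the smallest number of terms in a representation of it as a sum of outer products $\mathbf{a}\circ\mathbf{b}\circ\mathbf{c}$ of (real) vectors. *)

theory Defs
  imports "HOL-Analysis.Analysis"
begin

(* The matrix a b^T; column and row vectors are the one-column and one-row matrices. *)
definition vec_outer :: "real ^ 'm \<Rightarrow> real ^ 'n \<Rightarrow> real ^ 'n ^ 'm" where
  "vec_outer a b = (columnvector a :: real ^ 1 ^ 'm) ** (rowvector b :: real ^ 'n ^ 1)"

lemma vec_outer_nth: "vec_outer a b $ i $ j = a $ i * b $ j"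
  by (simp add: vec_outer_def matrix_matrix_mult_def columnvector_def rowvector_def)

(* A third-order tensor in R^(m x n x d) is a nested vector with entries T $ i $ j $ k. *)
type_synonym ('m, 'n, 'd) tensor3 = "real ^ 'd ^ 'n ^ 'm"

definition outer3 :: "real ^ 'm \<Rightarrow> real ^ 'n \<Rightarrow> real ^ 'd \<Rightarrow> ('m, 'n, 'd) tensor3" where
  "outer3 a b c = (\<chi> i j k. a $ i * b $ j * c $ k)"

definition slice3 :: "('m::finite, 'n::finite, 'd::finite) tensor3 \<Rightarrow> 'd \<Rightarrow> real ^ 'n ^ 'm" where
  "slice3 T k = (\<chi> i j. T $ i $ j $ k)"

definition cp_decomposition ::
  "nat \<Rightarrow> (nat \<Rightarrow> real ^ 'm) \<Rightarrow> (nat \<Rightarrow> real ^ 'n) \<Rightarrow> (nat \<Rightarrow> real ^ 'd) \<Rightarrow> ('m, 'n, 'd) tensor3 \<Rightarrow> bool"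
  where "cp_decomposition r a b c T \<longleftrightarrow> T = (\<Sum>l<r. outer3 (a l) (b l) (c l))"

definition tensor_rank :: "('m::finite, 'n::finite, 'd::finite) tensor3 \<Rightarrow> nat" where
  "tensor_rank T = (LEAST r. \<exists>a b c. cp_decomposition r a b c T)"

(* The minimum in tensor_rank is over a nonempty set. *)
lemma cp_decomposition_exists:
  fixes T :: "('m::finite, 'n::finite, 'd::finite) tensor3"
  shows "\<exists>r a b c. cp_decomposition r a b c T"
proof -
  let ?I = "UNIV :: ('m \<times> 'n \<times> 'd) set"
  let ?o = "\<lambda>(i, j, k). outer3 (axis i (T $ i $ j $ k)) (axis j 1) (axis k 1)"
  have "(\<Sum>p\<in>?I. ?o p) = T"
  proof -
    have "(\<Sum>p\<in>?I. ?o p) $ i $ j $ k = T $ i $ j $ k" for i j k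
    proof -
      have "(\<Sum>p\<in>?I. ?o p) $ i $ j $ k
          = (\<Sum>p\<in>?I. if p = (i, j, k) then T $ i $ j $ k else 0)"
        unfolding sum_component
        by (rule sum.cong) (auto simp: outer3_def axis_def split: prod.splits)
      then show ?thesis by simp
    qed
    then show ?thesis by (simp add: vec_eq_iff)
  qed
  moreover obtain h where h: "bij_betw h {..<card ?I} ?I"
    using ex_bij_betw_nat_finite[of ?I] by (auto simp: atLeast0LessThan)
  ultimately have "T = (\<Sum>l<card ?I. ?o (h l))"
    using sum.reindex_bij_betw[OF h, of ?o] by simp
  then have "cp_decomposition (card ?I)
      (\<lambda>l. case h l of (i, j, k) \<Rightarrow> axis i (T $ i $ j $ k))
      (\<lambda>l. axis (fst (snd (h l))) 1) (\<lambda>l. axis (snd (snd (h l))) 1) T"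
    unfolding cp_decomposition_def by (simp add: case_prod_unfold)
  then show ?thesis by blast
qed

definition basis_of :: "'v::real_vector set \<Rightarrow> 'v set \<Rightarrow> bool" where
  "basis_of B V \<longleftrightarrow> independent B \<and> span B = V"

end

(* Taken slice by slice, a CP decomposition of length r says that every slice is a linear
   combination of the r matrices a_l b_l^T. These matrices therefore generate a space containing
   the d independent slices, so r \<ge> d, and for r = d they must form a basis of the span of the
   slices. Conversely, the coefficients of the slices in a rank-one basis are the vectors c_l. *)

theory Submission
  imports Defs
begin

lemma slice3_eq_iff: "(\<forall>k. slice3 S k = slice3 T k) \<longleftrightarrow> S = T"
  by (auto simp: slice3_def vec_eq_iff)

lemma slice3_sum_outer3:
  "slice3 (\<Sum>l\<in>L. outer3 (a l) (b l) (c l)) k = (\<Sum>l\<in>L. c l $ k *\<^sub>R vec_outer (a l) (b l))"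
  by (simp add: slice3_def outer3_def vec_eq_iff vec_outer_nth mult.commute)

lemma cp_decomposition_iff_slices:
  "cp_decomposition r a b c T \<longleftrightarrow> (\<forall>k. slice3 T k = (\<Sum>l<r. c l $ k *\<^sub>R vec_outer (a l) (b l)))"
  unfolding cp_decomposition_def slice3_eq_iff[symmetric] slice3_sum_outer3 ..

text \<open>The product factors through a matrix with a single column, so its rank is at most 1, and
  a nonzero matrix has nonzero rank.\<close>

lemma rank_vec_outer:
  fixes a :: "real ^ 'm::finite" and b :: "real ^ 'n::finite"
  assumes "vec_outer a b \<noteq> 0"
  shows "rank (vec_outer a b) = 1"
proof -
  have "rank (vec_outer a b) \<le> rank (columnvector a :: real ^ 1 ^ 'm)"
    unfolding vec_outer_def by (rule rank_mul_le_left)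
  also have "\<dots> \<le> 1"
    using rank_bound[of "columnvector a :: real ^ 1 ^ 'm"] by simp
  finally show ?thesis
    using assms rank_eq_0[of "vec_outer a b"] by linarith
qed

text \<open>The row space is a line: \<open>b\<close> is a generator of it, and the entries of
  \<open>a\<close> are the multiples of \<open>b\<close> that occur as rows.\<close>

lemma rank_one_imp_vec_outer:
  fixes A :: "real ^ 'n::finite ^ 'm::finite"
  assumes "rank A = 1"
  obtains a b where "A = vec_outer a b"
proof -
  have "dim (rows A) = 1"
    using assms by (simp add: row_rank_def)
  then obtain B where B: "rows A \<subseteq> span B" "card B = 1"
    by (metis basis_exists)
  then obtain b where "rows A \<subseteq> span {b}"
    by (metis card_1_singletonE)
  then have "\<forall>i. \<exists>t. row i A = t *\<^sub>R b"
    by (auto simp: rows_def span_singleton)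
  then obtain t where "\<And>i. row i A = t i *\<^sub>R b"
    by metis
  then have "A = vec_outer (\<chi> i. t i) b"
    by (simp add: row_def vec_eq_iff vec_outer_nth)
  then show ?thesis ..
qed

context
  fixes T :: "('m::finite, 'n::finite, 'd::finite) tensor3"
  assumes inj_slices: "inj (slice3 T)"
    and indep_slices: "independent (range (slice3 T))"
begin

text \<open>Independence of a range is a statement about a set and does not see repeated slices;
  injectivity is what makes the dimension equal to the number of indices.\<close>

lemma dim_span_slices: "dim (span (range (slice3 T))) = CARD('d)"
  by (simp add: dim_eq_card_independent[OF indep_slices] card_image[OF inj_slices])

lemma span_slices_subset:
  assumes "cp_decomposition r a b c T"
  shows "span (range (slice3 T)) \<subseteq> span ((\<lambda>l. vec_outer (a l) (b l)) ` {..<r})"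
proof (rule span_minimal)
  show "range (slice3 T) \<subseteq> span ((\<lambda>l. vec_outer (a l) (b l)) ` {..<r})"
    using assms unfolding cp_decomposition_iff_slices
    by (auto intro: span_sum span_scale span_base)
qed (rule subspace_span)

lemma dim_vec_outers_ge:
  assumes "cp_decomposition r a b c T"
  shows "CARD('d) \<le> dim ((\<lambda>l. vec_outer (a l) (b l)) ` {..<r})"
  using dim_subset[OF span_slices_subset[OF assms]] dim_span_slices by simp

lemma cp_decomposition_length_ge:
  assumes "cp_decomposition r a b c T"
  shows "CARD('d) \<le> r"
proof -
  have "CARD('d) \<le> dim ((\<lambda>l. vec_outer (a l) (b l)) ` {..<r})"
    using assms by (rule dim_vec_outers_ge)
  also have "\<dots> \<le> card ((\<lambda>l. vec_outer (a l) (b l)) ` {..<r})"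
    by (rule dim_le_card') simp
  also have "\<dots> \<le> r"
    using card_image_le[of "{..<r}"] by simp
  finally show ?thesis .
qed

text \<open>The lower bound on the length makes every decomposition of length d minimal. Conversely,
  the minimum is attained because some decomposition exists.\<close>

lemma tensor_rank_eq_card_iff:
  "tensor_rank T = CARD('d) \<longleftrightarrow> (\<exists>a b c. cp_decomposition CARD('d) a b c T)"
proof
  assume "tensor_rank T = CARD('d)"
  then show "\<exists>a b c. cp_decomposition CARD('d) a b c T"
    using LeastI_ex[OF cp_decomposition_exists[of T]] by (simp add: tensor_rank_def)
next
  assume "\<exists>a b c. cp_decomposition CARD('d) a b c T"
  then show "tensor_rank T = CARD('d)"
    unfolding tensor_rank_def
    by (intro Least_equality) (auto dest: cp_decomposition_length_ge)
qed

text \<open>The chain d \<le> \<open>dim S\<close> \<le> \<open>card S\<close> \<le> d collapses to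
  equalities. The last one gives injectivity, the middle one independence, and the inclusion of the
  span of the slices in \<open>span S\<close> becomes an equality by dimension.\<close>

lemma minimal_cp_decomposition_basis:
  assumes cp: "cp_decomposition CARD('d) a b c T"
  defines "S \<equiv> (\<lambda>l. vec_outer (a l) (b l)) ` {..<CARD('d)}"
  shows "inj_on (\<lambda>l. vec_outer (a l) (b l)) {..<CARD('d)}"
    and "basis_of S (span (range (slice3 T)))"
    and "\<And>l. l < CARD('d) \<Longrightarrow> rank (vec_outer (a l) (b l)) = 1"
proof -
  have fin: "finite S" and le: "card S \<le> CARD('d)"
    unfolding S_def using card_image_le[of "{..<CARD('d)}"] by auto
  have ge: "CARD('d) \<le> dim S"
    using dim_vec_outers_ge[OF cp] by (simp add: S_def)
  have dim_card: "dim S \<le> card S"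
    using fin by (rule dim_le_card')
  show "inj_on (\<lambda>l. vec_outer (a l) (b l)) {..<CARD('d)}"
    using le ge dim_card by (intro eq_card_imp_inj_on) (auto simp: S_def)
  have indep: "independent S"
    using le ge fin by (intro card_le_dim_spanning[of S "span S"]) (auto simp: span_superset)
  have "span (range (slice3 T)) = span S"
    using span_slices_subset[OF cp] dim_span_slices le dim_card
    by (intro subspace_dim_equal) (auto simp: S_def)
  then show "basis_of S (span (range (slice3 T)))"
    using indep by (simp add: basis_of_def)
  \<comment> \<open>An independent set does not contain 0, so none of the products vanishes.\<close>
  show "rank (vec_outer (a l) (b l)) = 1" if "l < CARD('d)" for l
    using that indep dependent_zero[of S] by (intro rank_vec_outer) (auto simp: S_def)
qed

lemma rank_one_basis_imp_cp_decomposition: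
  assumes B: "basis_of B (span (range (slice3 T)))" and rank1: "\<And>A. A \<in> B \<Longrightarrow> rank A = 1"
  obtains a b c where "cp_decomposition CARD('d) a b c T"
proof -
  have fin: "finite B"
    using B by (simp add: basis_of_def independent_imp_finite)
  have "card B = CARD('d)"
    using B dim_span_slices by (metis basis_of_def dim_span_eq_card_independent)
  \<comment> \<open>The basis is a mere set, while the terms of a decomposition are indexed by
    numbers; \<open>h\<close> enumerates the basis.\<close>
  then obtain h where h: "bij_betw h {..<CARD('d)} B"
    using ex_bij_betw_nat_finite[OF fin] by (auto simp: atLeast0LessThan)
  have "\<forall>A\<in>B. \<exists>a b. A = vec_outer a b"
    using rank1 rank_one_imp_vec_outer by metis
  then obtain a b where ab: "\<And>A. A \<in> B \<Longrightarrow> A = vec_outer (a A) (b A)"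
    by metis
  have "\<exists>u. slice3 T k = (\<Sum>A\<in>B. u A *\<^sub>R A)" for k
  proof -
    have "slice3 T k \<in> span B"
      using B by (auto simp: basis_of_def span_base)
    then show ?thesis
      by (auto simp: span_finite[OF fin])
  qed
  then obtain u where u: "\<And>k. slice3 T k = (\<Sum>A\<in>B. u k A *\<^sub>R A)"
    by metis
  \<comment> \<open>The coefficients are transposed: the vector for \<open>l\<close> collects, over
    all slices, the coefficient at the basis matrix \<open>h l\<close>.\<close>
  have "slice3 T k = (\<Sum>l<CARD('d). (\<chi> k. u k (h l)) $ k *\<^sub>R vec_outer (a (h l)) (b (h l)))" for k
  proof -
    have "slice3 T k = (\<Sum>A\<in>B. u k A *\<^sub>R vec_outer (a A) (b A))"
      unfolding u using ab by (intro sum.cong) auto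
    then show ?thesis
      by (simp add: sum.reindex_bij_betw[OF h, symmetric])
  qed
  then have "cp_decomposition CARD('d) (\<lambda>l. a (h l)) (\<lambda>l. b (h l)) (\<lambda>l. \<chi> k. u k (h l)) T"
    unfolding cp_decomposition_iff_slices by blast
  then show ?thesis
    by (rule that)
qed

end

theorem proposition8:
  fixes M :: "'d::finite \<Rightarrow> real ^ 'n::finite ^ 'm::finite"
    and T :: "('m, 'n, 'd) tensor3"
    and MM :: "(real ^ 'n ^ 'm) set"
  assumes indep: "inj M" "independent (range M)"
    and space: "MM = span (range M)"
    and slices: "\<And>k. slice3 T k = M k"
  shows "((\<exists>B. basis_of B MM \<and> (\<forall>A\<in>B. rank A = 1)) \<longleftrightarrow> tensor_rank T = CARD('d)) \<and>
    (\<forall>a b c. cp_decomposition CARD('d) a b c T \<longrightarrow>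
      inj_on (\<lambda>l. vec_outer (a l) (b l)) {..<CARD('d)} \<and>
      basis_of ((\<lambda>l. vec_outer (a l) (b l)) ` {..<CARD('d)}) MM \<and>
      (\<forall>l<CARD('d). rank (vec_outer (a l) (b l)) = 1))"
proof -
  have M: "M = slice3 T"
    using slices by auto
  \<comment> \<open>These two facts discharge the standing assumptions on the slices in the lemmas
    above.\<close>
  note T = indep[unfolded M]
  have decomp: "inj_on (\<lambda>l. vec_outer (a l) (b l)) {..<CARD('d)} \<and>
      basis_of ((\<lambda>l. vec_outer (a l) (b l)) ` {..<CARD('d)}) MM \<and>
      (\<forall>l<CARD('d). rank (vec_outer (a l) (b l)) = 1)"
    if "cp_decomposition CARD('d) a b c T" for a b c
    using minimal_cp_decomposition_basis[OF T that] by (simp add: space M)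
  have "(\<exists>B. basis_of B MM \<and> (\<forall>A\<in>B. rank A = 1)) \<longleftrightarrow>
      (\<exists>a b c. cp_decomposition CARD('d) a b c T)"
  proof
    assume "\<exists>B. basis_of B MM \<and> (\<forall>A\<in>B. rank A = 1)"
    then show "\<exists>a b c. cp_decomposition CARD('d) a b c T"
      using rank_one_basis_imp_cp_decomposition[OF T] unfolding space M by metis
  next
    assume "\<exists>a b c. cp_decomposition CARD('d) a b c T"
    then obtain a b c where "cp_decomposition CARD('d) a b c T"
      by blast
    from decomp[OF this] show "\<exists>B. basis_of B MM \<and> (\<forall>A\<in>B. rank A = 1)"
      by (intro exI[of _ "(\<lambda>l. vec_outer (a l) (b l)) ` {..<CARD('d)}"]) auto
  qed
  then show ?thesis
    using decomp by (simp add: tensor_rank_eq_card_iff[OF T])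
qed

end
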